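(* There exists $T>2$ such that for all $t\ge T$, $$\frac{(64+49\pi^2)\,t}{196\,\pi^2}\le\int_{\mathbf{R}}\frac{(1+|\xi|^2)^{-t}\sin^2\left(t\sqrt{\log(1+|\xi|^2)}\right)}{\log(1+|\xi|^2)}\,d\xi\le12\,t.$$ *)

theory Defs
  imports "HOL-Analysis.Analysis"
begin

end

(* On the interval of length 2/t around the origin the integrand is comparable to t^2, and globally it is
   dominated by both t^2 (from sin s <= s) and 1/xi^2 (from ln(1 + xi^2) >= xi^2/(1 + xi^2)), hence by the
   Cauchy kernel 2 t^2 / (1 + t^2 xi^2), of integral 2 pi t. The claimed constants are weak
   enough (the true asymptotics is pi t) for these crude bounds to suffice. *)
theory Submission
  imports Defs
begin

text \<open>The antiderivative \<open>arctan (t * x)\<close> climbs from -pi/2 to pi/2. Since the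
  kernel is nonnegative, the fundamental theorem on the whole line yields integrability together
  with the value.\<close>

lemma has_bochner_integral_scaled_Cauchy_kernel:
  fixes t :: real
  assumes t: "t > 0"
  shows "has_bochner_integral lborel (\<lambda>x. t / (1 + (t * x)\<^sup>2)) pi"
proof -
  let ?f = "\<lambda>x. t / (1 + (t * x)\<^sup>2)" and ?F = "\<lambda>x. arctan (t * x)"
  have pos: "1 + (t * x)\<^sup>2 > 0" for x
    by (rule add_pos_nonneg) auto
  have deriv: "DERIV ?F x :> ?f x" for x
    using pos[of x] by (auto intro!: derivative_eq_intros simp: field_simps)
  have cont: "isCont ?f x" for x
    using pos[of x] by (intro continuous_intros) auto
  have nonneg: "?f x \<ge> 0" for x
    using t pos[of x] by simp
  have "filterlim (\<lambda>x. t * x) at_bot at_bot" "filterlim (\<lambda>x. t * x) at_top at_top"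
    using t filterlim_tendsto_pos_mult_at_bot[OF tendsto_const t filterlim_ident]
      filterlim_tendsto_pos_mult_at_top[OF tendsto_const t filterlim_ident] by auto
  then have lims: "(?F \<longlongrightarrow> - (pi / 2)) at_bot" "(?F \<longlongrightarrow> pi / 2) at_top"
    by (auto intro: filterlim_compose[OF tendsto_arctan_at_bot] filterlim_compose[OF tendsto_arctan_at_top])
  \<comment> \<open>Folding with \<open>ereal_tendsto_simps1\<close> turns limits along
    \<open>at_bot\<close> and \<open>at_top\<close> into one-sided limits at the infinite endpoints,
    the form this theorem expects.\<close>
  note FTC = interval_integral_FTC_nonneg[of "-\<infinity>" "\<infinity>" ?F ?f "- (pi / 2)" "pi / 2",
      OF _ deriv cont _ lims[folded ereal_tendsto_simps1]]
  have "set_integrable lborel UNIV ?f" "(LBINT x=-\<infinity>..\<infinity>. ?f x) = pi"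
    using FTC nonneg by auto
  then show ?thesis
    by (auto simp: has_bochner_integral_iff interval_lebesgue_integral_def set_integrable_def
        set_lebesgue_integral_def)
qed

text \<open>The Taylor remainder is at most x^3/6 <= x/6, which leaves 5x/6.\<close>

lemma half_le_sin:
  fixes x :: real
  assumes "0 \<le> x" "x \<le> 1"
  shows "x / 2 \<le> sin x"
proof -
  have "\<bar>sin x - x\<bar> \<le> x ^ 3 / 6"
    using Maclaurin_sin_bound[of x 3] assms
    by (simp add: eval_nat_numeral sin_coeff_def field_simps)
  moreover have "x ^ 3 \<le> x"
    using assms power_decreasing[of 1 3 x] by simp
  ultimately show ?thesis
    using assms by linarith
qed

text \<open>This is ln y <= y - 1 at y = 1/(1 + x^2), with signs reversed.\<close>

lemma ln_one_plus_square_ge: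
  fixes x :: real
  shows "x\<^sup>2 / (1 + x\<^sup>2) \<le> ln (1 + x\<^sup>2)"
proof -
  have pos: "1 + x\<^sup>2 > 0"
    by (rule add_pos_nonneg) auto
  then have "ln (1 / (1 + x\<^sup>2)) \<le> 1 / (1 + x\<^sup>2) - 1"
    by (intro ln_le_minus_one) simp
  then show ?thesis
    using pos by (simp add: ln_div field_simps)
qed

lemma integrand_upper_bound:
  fixes t x :: real
  assumes t: "t \<ge> 1"
  shows "(1 + x\<^sup>2) powr (- t) * (sin (t * sqrt (ln (1 + x\<^sup>2))))\<^sup>2 / ln (1 + x\<^sup>2)
           \<le> 2 * t * (t / (1 + (t * x)\<^sup>2))"
proof (cases "x = 0")
  case False
  define L where "L = ln (1 + x\<^sup>2)"
  define w where "w = (1 + x\<^sup>2) powr (- t)"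
  define s where "s = (sin (t * sqrt L))\<^sup>2"
  have x: "x\<^sup>2 > 0"
    using False by simp
  then have L: "L > 0"
    unfolding L_def by (intro ln_gt_zero) linarith
  have s: "0 \<le> s" "s \<le> 1" "s \<le> t\<^sup>2 * L"
  proof -
    show "0 \<le> s" "s \<le> 1"
      by (auto simp: s_def abs_square_le_1)
    have "\<bar>sin (t * sqrt L)\<bar> \<le> \<bar>t * sqrt L\<bar>"
      by (rule abs_sin_x_le_abs_x)
    then have "s \<le> (t * sqrt L)\<^sup>2"
      unfolding s_def by (rule iffD1[OF abs_le_square_iff])
    then show "s \<le> t\<^sup>2 * L"
      using L by (simp add: power_mult_distrib)
  qed
  \<comment> \<open>From t >= 1: the weight decays at least like 1/(1 + x^2), exactly the factor
    lost in the lower bound on the logarithm.\<close>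
  have "w \<le> (1 + x\<^sup>2) powr (- 1)"
    unfolding w_def using t x by (intro powr_mono) auto
  then have w: "0 \<le> w" "w \<le> 1 / (1 + x\<^sup>2)"
    using x by (auto simp: w_def powr_minus_divide)
  moreover have "1 / (1 + x\<^sup>2) \<le> 1"
    using x by (subst divide_le_eq_1_pos) linarith+
  ultimately have w1: "w \<le> 1"
    by linarith
  have "w * s \<le> 1 * (t\<^sup>2 * L)"
    using w w1 s by (intro mult_mono) auto
  then have a: "w * s / L \<le> t\<^sup>2"
    using L by (simp add: divide_le_eq)
  have "w * s * x\<^sup>2 \<le> 1 / (1 + x\<^sup>2) * 1 * x\<^sup>2"
    using w s by (intro mult_mono) auto
  also have "\<dots> \<le> L"
    using ln_one_plus_square_ge[of x] by (simp add: L_def)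
  finally have b: "w * s / L * x\<^sup>2 \<le> 1"
    using L by (simp add: divide_le_eq)
  \<comment> \<open>Adding bound \<open>a\<close> to t^2 times bound \<open>b\<close> merges the two
    estimates into the single Cauchy kernel.\<close>
  have "w * s / L * (1 + (t * x)\<^sup>2) = w * s / L + t\<^sup>2 * (w * s / L * x\<^sup>2)"
    by (simp add: algebra_simps power_mult_distrib add_divide_distrib)
  also have "\<dots> \<le> t\<^sup>2 + t\<^sup>2 * 1"
    using a b by (intro add_mono mult_left_mono) auto
  finally have "w * s / L * (1 + (t * x)\<^sup>2) \<le> 2 * t * t"
    by (simp add: power2_eq_square)
  moreover have "1 + (t * x)\<^sup>2 > 0"
    by (rule add_pos_nonneg) auto
  ultimately have "w * s / L \<le> 2 * t * t / (1 + (t * x)\<^sup>2)"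
    by (subst pos_le_divide_eq)
  then show ?thesis
    by (simp add: w_def s_def L_def)
\<comment> \<open>At x = 0 the left side is 0, because division by ln 1 = 0 gives 0.\<close>
qed simp

text \<open>Near the origin the weight is at least 2/3 and the squared sine at least t^2 L/4 with L
  = ln(1 + x^2). Dividing their product by L leaves t^2/6.\<close>

lemma integrand_lower_bound:
  fixes t x :: real
  assumes t: "t \<ge> 3" and x: "x \<noteq> 0" "\<bar>x\<bar> \<le> 1 / t"
  shows "t\<^sup>2 / 6 \<le> (1 + x\<^sup>2) powr (- t) * (sin (t * sqrt (ln (1 + x\<^sup>2))))\<^sup>2 / ln (1 + x\<^sup>2)"
proof -
  define L where "L = ln (1 + x\<^sup>2)"
  have x2: "x\<^sup>2 > 0"
    using x by simp
  have L: "L > 0" "L \<le> x\<^sup>2"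
    using x2 ln_add_one_self_le_self[of "x\<^sup>2"] ln_gt_zero[of "1 + x\<^sup>2"] unfolding L_def by linarith+
  have tx: "t * \<bar>x\<bar> \<le> 1"
    using x t by (simp add: field_simps)
  \<comment> \<open>The chain t L <= t x^2 <= |x| <= 1/t <= 1/3 feeds exp y >= 1 + y at y = -t
    L.\<close>
  have "t * L \<le> t * (\<bar>x\<bar> * \<bar>x\<bar>)"
    using L t by (intro mult_left_mono) (auto simp: power2_eq_square)
  also have "\<dots> = (t * \<bar>x\<bar>) * \<bar>x\<bar>"
    by simp
  also have "\<dots> \<le> 1 * \<bar>x\<bar>"
    using tx by (intro mult_right_mono) auto
  also have "\<dots> \<le> 1 / 3"
    using tx mult_right_mono[OF t, of "\<bar>x\<bar>"] by simp
  finally have "2 / 3 \<le> 1 + - t * L"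
    by simp
  also have "\<dots> \<le> exp (- t * L)"
    by (rule exp_ge_add_one_self)
  also have "\<dots> = (1 + x\<^sup>2) powr (- t)"
    using x2 add_pos_pos[OF zero_less_one x2] by (simp add: powr_def L_def)
  finally have w: "2 / 3 \<le> (1 + x\<^sup>2) powr (- t)" .
  have "sqrt L \<le> \<bar>x\<bar>"
    using L real_sqrt_le_mono[of L "x\<^sup>2"] by simp
  then have "t * sqrt L \<le> t * \<bar>x\<bar>"
    using t by simp
  then have "t * sqrt L \<le> 1"
    using tx by linarith
  then have "t * sqrt L / 2 \<le> sin (t * sqrt L)"
    using t L by (intro half_le_sin) auto
  then have "(t * sqrt L / 2)\<^sup>2 \<le> (sin (t * sqrt L))\<^sup>2"
    using t L by (intro power_mono) auto
  then have "t\<^sup>2 * L / 4 \<le> (sin (t * sqrt L))\<^sup>2"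
    using L by (simp add: power_mult_distrib power_divide)
  then have "2 / 3 * (t\<^sup>2 * L / 4) \<le> (1 + x\<^sup>2) powr (- t) * (sin (t * sqrt L))\<^sup>2"
    using w L by (intro mult_mono) auto
  then have "t\<^sup>2 / 6 \<le> (1 + x\<^sup>2) powr (- t) * (sin (t * sqrt L))\<^sup>2 / L"
    using L by (simp add: pos_le_divide_eq mult.commute)
  then show ?thesis
    by (simp add: L_def)
qed

theorem proposition6p1:
  "\<exists>T::real. T > 2 \<and> (\<forall>t::real. t \<ge> T \<longrightarrow>
     (64 + 49 * pi\<^sup>2) * t / (196 * pi\<^sup>2)
       \<le> (LINT \<xi>::real|lborel. (1 + \<bar>\<xi>\<bar>\<^sup>2) powr (- t) * (sin (t * sqrt (ln (1 + \<bar>\<xi>\<bar>\<^sup>2))))\<^sup>2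
                              / ln (1 + \<bar>\<xi>\<bar>\<^sup>2))
   \<and> (LINT \<xi>::real|lborel. (1 + \<bar>\<xi>\<bar>\<^sup>2) powr (- t) * (sin (t * sqrt (ln (1 + \<bar>\<xi>\<bar>\<^sup>2))))\<^sup>2
                              / ln (1 + \<bar>\<xi>\<bar>\<^sup>2))
       \<le> 12 * t)"
\<comment> \<open>The threshold 3 is what keeps the weight above 2/3 on [-1/t, 1/t].\<close>
proof (intro exI[of _ 3] conjI allI impI)
  fix t :: real
  assume t: "t \<ge> 3"
  define f where "f = (\<lambda>x::real. (1 + \<bar>x\<bar>\<^sup>2) powr (- t) * (sin (t * sqrt (ln (1 + \<bar>x\<bar>\<^sup>2))))\<^sup>2
                              / ln (1 + \<bar>x\<bar>\<^sup>2))"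
  define k where "k = (\<lambda>x. 2 * t * (t / (1 + (t * x)\<^sup>2)))"
  have "has_bochner_integral lborel k (2 * t * pi)"
    unfolding k_def using t
    by (intro has_bochner_integral_mult_right has_bochner_integral_scaled_Cauchy_kernel) auto
  then have k: "integrable lborel k" "integral\<^sup>L lborel k = 2 * t * pi"
    by (auto simp: has_bochner_integral_iff)
  have f0: "0 \<le> f x" for x
    unfolding f_def by (intro divide_nonneg_nonneg mult_nonneg_nonneg ln_ge_zero) auto
  have fk: "f x \<le> k x" for x
    unfolding f_def k_def using integrand_upper_bound[of t x] t by simp
  have "f \<in> borel_measurable lborel"
    unfolding f_def by measurable
  moreover have "norm (f x) \<le> norm (k x)" for x
    using f0[of x] fk[of x] by simp
  ultimately have f: "integrable lborel f"
    by (intro Bochner_Integration.integrable_bound[OF k(1)]) auto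
  have "integral\<^sup>L lborel f \<le> 2 * t * pi"
    using integral_mono[OF f k(1) fk] k(2) by simp
  also have "\<dots> \<le> 2 * t * 6"
    using t pi_less_4 by (intro mult_left_mono) auto
  finally show "(LINT \<xi>|lborel. (1 + \<bar>\<xi>\<bar>\<^sup>2) powr (- t) * (sin (t * sqrt (ln (1 + \<bar>\<xi>\<bar>\<^sup>2))))\<^sup>2
                              / ln (1 + \<bar>\<xi>\<bar>\<^sup>2)) \<le> 12 * t"
    by (simp add: f_def)
  let ?I = "{- (1 / t)..1 / t}"
  have "9 \<le> pi\<^sup>2"
    using pi_gt3 power_mono[of 3 pi 2] by simp
  \<comment> \<open>The coefficient equals 1/4 + 16/(49 pi^2), at most 1/4 + 16/441 < 1/3.\<close>
  then have "(64 + 49 * pi\<^sup>2) * t / (196 * pi\<^sup>2) \<le> t / 3"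
    using t by (auto simp: field_simps)
  \<comment> \<open>Interval length 2/t times height t^2/6.\<close>
  also have "t / 3 = (LINT x|lborel. indicator ?I x * (t\<^sup>2 / 6))"
    using t by (simp add: power2_eq_square)
  also have "\<dots> \<le> integral\<^sup>L lborel f"
  proof (rule integral_mono_AE)
    show "integrable lborel (\<lambda>x. indicator ?I x * (t\<^sup>2 / 6))"
      using t by (intro integrable_mult_left integrable_real_indicator) (auto simp: emeasure_lborel_Icc_eq)
    \<comment> \<open>The origin must be excluded: division by \<open>ln 1 = 0\<close> makes the integrand vanish there.\<close>
    show "AE x in lborel. indicator ?I x * (t\<^sup>2 / 6) \<le> f x"
      using AE_lborel_singleton[of 0]
    proof eventually_elim
      case (elim x)
      show ?case
        using integrand_lower_bound[OF t elim] f0[of x]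
        by (cases "x \<in> ?I") (auto simp: f_def abs_le_iff)
    qed
  qed (rule f)
  finally show "(64 + 49 * pi\<^sup>2) * t / (196 * pi\<^sup>2)
       \<le> (LINT \<xi>|lborel. (1 + \<bar>\<xi>\<bar>\<^sup>2) powr (- t) * (sin (t * sqrt (ln (1 + \<bar>\<xi>\<bar>\<^sup>2))))\<^sup>2
                              / ln (1 + \<bar>\<xi>\<bar>\<^sup>2))"
    by (simp only: f_def)
qed simp

end
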